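(* Let $k\ge1$ and suppose every metric space has $n\ge 3$ points. Then the competitive ratio (against an adaptive online adversary) of any randomized memoryless algorithm for the generalized $k$-server problem on uniform metrics is at least $k\cdot\alpha_k$, where $\alpha_1=1$ and $\alpha_\ell=1+(\ell-1)\alpha_{\ell-1}$ for $\ell>1$.
   Context: Generalized $k$-server problem on uniform metrics: there are $k$ uniform metric spaces $M_1,\dots,M_k$, each with point set $[n]$ and all pairwise distances equal to $1$. A configuration is $q\in[n]^k$. A request is $r\in[n]^k$; it is served by configuration $q$ if $q_i=r_i$ for some $i$, otherwise some server must move so that this holds. Moving one server to a different point costs $1$; the cost between configurations is the Hamming distance. A randomized memoryless algorithm is given by a probability distribution $(p_1,\dots,p_k)$: on request $r$, if its current configuration serves $r$ it does nothing; otherwise it picks $i$ with probability $p_i$ and moves server $s_i$ to $r_i$. An algorithm is $c$-competitive against an adaptive online adversary (which sees the algorithm's current configuration before choosing each request and must itself serve each request) if its expected cost is at most $c$ times the adversary's cost up to an additive constant; the competitive ratio is the infimum of such $c$. *)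

theory Defs
  imports "HOL-Probability.Probability"
begin

definition configs :: "nat \<Rightarrow> nat \<Rightarrow> (nat \<Rightarrow> nat) set" where
  "configs k n = {1..k} \<rightarrow>\<^sub>E {1..n}"

definition serves :: "nat \<Rightarrow> (nat \<Rightarrow> nat) \<Rightarrow> (nat \<Rightarrow> nat) \<Rightarrow> bool" where
  "serves k q r \<longleftrightarrow> (\<exists>i\<in>{1..k}. q i = r i)"

definition hamming :: "nat \<Rightarrow> (nat \<Rightarrow> nat) \<Rightarrow> (nat \<Rightarrow> nat) \<Rightarrow> nat" where
  "hamming k q q' = card {i \<in> {1..k}. q i \<noteq> q' i}"

definition memoryless_step ::
  "nat \<Rightarrow> nat pmf \<Rightarrow> (nat \<Rightarrow> nat) \<Rightarrow> (nat \<Rightarrow> nat) \<Rightarrow> (nat \<Rightarrow> nat) pmf" where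
  "memoryless_step k p r q =
     (if serves k q r then return_pmf q else map_pmf (\<lambda>i. q(i := r i)) p)"

text \<open>
  A history is the chronological list of the algorithm's configurations, starting with the
  initial one. An adaptive online adversary consists of two functions of the history: \<open>R h\<close> is
  the next request and \<open>A h\<close> is the adversary's own configuration after serving that request.
  Thus the adversary answers a request before the algorithm's move on it is drawn. The
  adversary's earlier configurations are determined by the prefixes of \<open>h\<close>, so they need not
  be arguments.
\<close>

definition adaptive_online_adversary ::
  "nat \<Rightarrow> nat \<Rightarrow> ((nat \<Rightarrow> nat) list \<Rightarrow> nat \<Rightarrow> nat) \<Rightarrow> ((nat \<Rightarrow> nat) list \<Rightarrow> nat \<Rightarrow> nat) \<Rightarrow> bool"
  where
  "adaptive_online_adversary k n R A \<longleftrightarrow>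
     (\<forall>h \<in> lists (configs k n).
        R h \<in> configs k n \<and> A h \<in> configs k n \<and> serves k (A h) (R h))"

primrec run ::
  "nat \<Rightarrow> nat pmf \<Rightarrow> ((nat \<Rightarrow> nat) list \<Rightarrow> nat \<Rightarrow> nat) \<Rightarrow> (nat \<Rightarrow> nat) \<Rightarrow> nat
     \<Rightarrow> (nat \<Rightarrow> nat) list pmf" where
  "run k p R q0 0 = return_pmf [q0]"
| "run k p R q0 (Suc t) =
     bind_pmf (run k p R q0 t)
       (\<lambda>h. map_pmf (\<lambda>q. h @ [q]) (memoryless_step k p (R h) (last h)))"

definition alg_cost :: "nat \<Rightarrow> nat \<Rightarrow> (nat \<Rightarrow> nat) list \<Rightarrow> nat" where
  "alg_cost k T h = (\<Sum>t<T. hamming k (h ! t) (h ! Suc t))"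

text \<open>The adversary's configuration after \<open>t\<close> requests; both players start in \<open>q0\<close>.\<close>

definition adv_config ::
  "((nat \<Rightarrow> nat) list \<Rightarrow> nat \<Rightarrow> nat) \<Rightarrow> (nat \<Rightarrow> nat) \<Rightarrow> (nat \<Rightarrow> nat) list \<Rightarrow> nat \<Rightarrow> nat \<Rightarrow> nat"
  where
  "adv_config A q0 h t = (if t = 0 then q0 else A (take t h))"

definition adv_cost ::
  "nat \<Rightarrow> ((nat \<Rightarrow> nat) list \<Rightarrow> nat \<Rightarrow> nat) \<Rightarrow> (nat \<Rightarrow> nat) \<Rightarrow> nat \<Rightarrow> (nat \<Rightarrow> nat) list \<Rightarrow> nat"
  where
  "adv_cost k A q0 T h = (\<Sum>t<T. hamming k (adv_config A q0 h t) (adv_config A q0 h (Suc t)))"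

definition competitive :: "nat \<Rightarrow> nat \<Rightarrow> nat pmf \<Rightarrow> real \<Rightarrow> bool" where
  "competitive k n p c \<longleftrightarrow>
     (\<forall>q0 \<in> configs k n. \<exists>b::real. \<forall>R A T. adaptive_online_adversary k n R A \<longrightarrow>
        measure_pmf.expectation (run k p R q0 T) (\<lambda>h. real (alg_cost k T h))
          \<le> c * measure_pmf.expectation (run k p R q0 T) (\<lambda>h. real (adv_cost k A q0 T h)) + b)"

text \<open>Extended real: the ratio is \<open>\<infinity>\<close> if the algorithm is not \<open>c\<close>-competitive for any \<open>c\<close>.\<close>

definition competitive_ratio :: "nat \<Rightarrow> nat \<Rightarrow> nat pmf \<Rightarrow> ereal" where
  "competitive_ratio k n p = Inf {ereal c | c. competitive k n p c}"

text \<open>The sequence starts at index 1; the value at 0 is a dummy.\<close>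

fun alpha :: "nat \<Rightarrow> nat" where
  "alpha 0 = 0"
| "alpha (Suc 0) = 1"
| "alpha (Suc (Suc l)) = 1 + Suc l * alpha (Suc l)"

end

(*
  The adversary keeps the positions where it disagrees with the algorithm on a stack whose bottom
  is the position m with the smallest p_m. Its request agrees with its own configuration at the
  top of the stack and differs from both configurations everywhere else (this takes 3 points), so
  the algorithm always pays 1. Moving the top server pops it, moving a server outside the stack
  pushes it, and moving any other server of the stack changes nothing. Only when the stack becomes
  empty does the adversary pay 1, to disagree at m again. Popping an element j from height l + 1
  takes an expected alpha_(k-l) / p_j requests: an element x pushed above it occurs with
  probability p_x and costs alpha_(k-l-1) / p_x requests to remove, for k - l - 1 choices of x,
  and alpha_(k-l) = 1 + (k-l-1) alpha_(k-l-1). Since p_m <= 1/k, emptying the stack takes at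
  least k alpha_k requests on average.
*)
theory Submission
  imports Defs
begin

section \<open>Recurrences for \<open>alpha\<close> and the costs, and finite expectations\<close>

lemma alpha_Suc: "alpha (Suc l) = 1 + l * alpha l"
  by (cases l) auto

lemma expectation_bind_finite:
  fixes f :: "'b \<Rightarrow> real"
  assumes "finite (set_pmf p)" "\<And>x. x \<in> set_pmf p \<Longrightarrow> finite (set_pmf (g x))"
  shows "measure_pmf.expectation (bind_pmf p g) f
    = measure_pmf.expectation p (\<lambda>x. measure_pmf.expectation (g x) f)"
proof -
  have "measure_pmf.expectation (bind_pmf p g) f
      = (\<Sum>x\<in>set_pmf p. pmf p x *\<^sub>R measure_pmf.expectation (g x) f)"
    using assms by (intro pmf_expectation_bind) auto
  also have "\<dots> = measure_pmf.expectation p (\<lambda>x. measure_pmf.expectation (g x) f)"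
    by (subst integral_measure_pmf[OF assms(1)]) (auto simp: mult.commute)
  finally show ?thesis .
qed

lemma finite_set_pmf_run:
  assumes "finite (set_pmf p)"
  shows "finite (set_pmf (run k p R q0 t))"
  by (induction t) (use assms in \<open>auto simp: memoryless_step_def\<close>)

lemma expectation_mono_finite:
  fixes f g :: "'a \<Rightarrow> real"
  assumes "finite (set_pmf p)" "\<And>x. x \<in> set_pmf p \<Longrightarrow> f x \<le> g x"
  shows "measure_pmf.expectation p f \<le> measure_pmf.expectation p g"
  by (rule integral_mono_AE)
    (use assms in \<open>auto simp: AE_measure_pmf_iff intro: integrable_measure_pmf_finite\<close>)

lemma hamming_update:
  assumes "i \<in> {1..k}" "x \<noteq> q i"
  shows "hamming k q (q(i := x)) = 1"
proof -
  have "{j \<in> {1..k}. q j \<noteq> (q(i := x)) j} = {i}"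
    using assms by auto
  then show ?thesis
    by (simp add: hamming_def)
qed

lemma hamming_self [simp]: "hamming k q q = 0"
  by (simp add: hamming_def)

lemma alg_cost_snoc:
  assumes "length h = Suc t"
  shows "alg_cost k (Suc t) (h @ [q]) = alg_cost k t h + hamming k (last h) q"
proof -
  have "h \<noteq> []" using assms by auto
  then show ?thesis
    using assms by (auto simp: alg_cost_def nth_append last_conv_nth)
qed

text \<open>The prefixes up to length \<open>t\<close> already fix the adversary's first
  \<open>t\<close> moves, so appending \<open>q\<close> adds only the last one.\<close>

lemma adv_cost_snoc:
  assumes "length h = t"
  shows "adv_cost k A q0 (Suc t) (h @ [q])
    = adv_cost k A q0 t h + hamming k (adv_config A q0 h t) (A (h @ [q]))"
proof -
  have "(\<Sum>i<t. hamming k (adv_config A q0 (h @ [q]) i) (adv_config A q0 (h @ [q]) (Suc i)))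
      = (\<Sum>i<t. hamming k (adv_config A q0 h i) (adv_config A q0 h (Suc i)))"
    using assms by (intro sum.cong refl) (simp add: adv_config_def)
  then show ?thesis
    using assms by (simp add: adv_cost_def adv_config_def)
qed

lemma adv_cost_mono: "adv_cost k A q0 t h \<le> adv_cost k A q0 (Suc t) h"
  by (simp add: adv_cost_def)

section \<open>The adversary's strategy and its invariant\<close>

locale stack_adversary =
  fixes k n m :: nat and q0 :: "nat \<Rightarrow> nat"
  assumes n3: "n \<ge> 3" and m: "m \<in> {1..k}" and q0: "q0 \<in> configs k n"
begin

definition fresh :: "nat \<Rightarrow> nat \<Rightarrow> nat" where
  "fresh u v = (SOME x. x \<in> {1..n} \<and> x \<noteq> u \<and> x \<noteq> v)"

text \<open>Two excluded values leave one of the points 1, 2, 3; this is where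
  \<open>n \<ge> 3\<close> enters.\<close>

lemma fresh: "fresh u v \<in> {1..n}" "fresh u v \<noteq> u" "fresh u v \<noteq> v"
proof -
  have "\<exists>x \<in> {1,2,3}. x \<noteq> u \<and> x \<noteq> v" by auto
  then have "\<exists>x. x \<in> {1..n} \<and> x \<noteq> u \<and> x \<noteq> v" using n3 by force
  from someI_ex[OF this] show "fresh u v \<in> {1..n}" "fresh u v \<noteq> u" "fresh u v \<noteq> v"
    by (auto simp: fresh_def)
qed

text \<open>
  Maps the reversed history to the adversary's configuration after serving the next request,
  together with a stack (topmost element first) of the positions where it disagrees with
  the algorithm.
\<close>

primrec strategy :: "(nat \<Rightarrow> nat) list \<Rightarrow> (nat \<Rightarrow> nat) \<times> nat list" where
  "strategy [] = (q0(m := fresh (q0 m) (q0 m)), [m])"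
| "strategy (q # h) =
    (let (a, s) = strategy h;
         s' = [i \<leftarrow> [1..<Suc k]. q i \<noteq> a i \<and> i \<notin> set s] @ [i \<leftarrow> s. q i \<noteq> a i]
     in if s' = [] then (a(m := fresh (a m) (a m)), [m]) else (a, s'))"

definition answer :: "(nat \<Rightarrow> nat) list \<Rightarrow> nat \<Rightarrow> nat" where
  "answer h = fst (strategy (rev h))"

definition stack :: "(nat \<Rightarrow> nat) list \<Rightarrow> nat list" where
  "stack h = snd (strategy (rev h))"

text \<open>Avoiding the adversary's position ensures that a server moved away from the top ends in
  disagreement. The default \<open>q0\<close> in \<open>last (q0 # h)\<close> serves the empty
  history.\<close>

definition request :: "(nat \<Rightarrow> nat) list \<Rightarrow> nat \<Rightarrow> nat" where
  "request h = (\<lambda>i\<in>{1..k}. if i = hd (stack h) then answer h i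
                           else fresh (last (q0 # h) i) (answer h i))"

lemma strategy_snoc:
  fixes h q
  defines "s' \<equiv> [i \<leftarrow> [1..<Suc k]. q i \<noteq> answer h i \<and> i \<notin> set (stack h)]
                @ [i \<leftarrow> stack h. q i \<noteq> answer h i]"
  shows "answer (h @ [q]) =
      (if s' = [] then (answer h)(m := fresh (answer h m) (answer h m)) else answer h)"
    and "stack (h @ [q]) = (if s' = [] then [m] else s')"
  by (simp_all add: s'_def answer_def stack_def case_prod_beta Let_def)

lemma config_update: "q \<in> configs k n \<Longrightarrow> i \<in> {1..k} \<Longrightarrow> x \<in> {1..n} \<Longrightarrow> q(i := x) \<in> configs k n"
  by (auto simp: configs_def PiE_def Pi_def extensional_def)

text \<open>An adversary must be legal on every list of configurations, even one that no run
  produces, so consecutive configurations may differ arbitrarily here. This is why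
  \<open>strategy\<close> filters all positions instead of doing a single push or pop.\<close>

lemma strategy_invariant:
  assumes "h \<in> lists (configs k n)"
  shows "answer h \<in> configs k n \<and> stack h \<noteq> [] \<and> distinct (stack h) \<and>
    set (stack h) = {i \<in> {1..k}. last (q0 # h) i \<noteq> answer h i}"
  using assms
proof (induction h rule: rev_induct)
  case Nil
  define a where "a = q0(m := fresh (q0 m) (q0 m))"
  have "answer [] = a" "stack [] = [m]"
    by (simp_all add: answer_def stack_def a_def)
  moreover have "a \<in> configs k n"
    unfolding a_def by (rule config_update[OF q0 m fresh(1)])
  moreover have "{i \<in> {1..k}. q0 i \<noteq> a i} = {m}"
    using m fresh(2)[of "q0 m" "q0 m"] by (auto simp: a_def)
  ultimately show ?case by simp
next
  case (snoc q h)
  then have IH: "answer h \<in> configs k n" "distinct (stack h)"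
      "set (stack h) = {i \<in> {1..k}. last (q0 # h) i \<noteq> answer h i}"
    by auto
  let ?s = "[i \<leftarrow> [1..<Suc k]. q i \<noteq> answer h i \<and> i \<notin> set (stack h)]
                @ [i \<leftarrow> stack h. q i \<noteq> answer h i]"
  have set_s: "set ?s = {i \<in> {1..k}. q i \<noteq> answer h i}"
  proof -
    have "set (stack h) \<subseteq> {1..k}" unfolding IH(3) by blast
    then show ?thesis by (auto simp: subset_iff)
  qed
  show ?case
  proof (cases "?s = []")
    case True
    \<comment> \<open>An empty stack means full agreement, so changing \<open>m\<close> alone
      creates exactly one disagreement.\<close>
    then have "\<And>i. i \<in> {1..k} \<Longrightarrow> q i = answer h i"
      using set_s unfolding True by simp
    then have "{i \<in> {1..k}. q i \<noteq> ((answer h)(m := fresh (answer h m) (answer h m))) i} = {m}"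
      using m fresh(2)[of "answer h m" "answer h m"] by force
    then show ?thesis
      unfolding strategy_snoc if_P[OF True] using config_update[OF IH(1) m fresh(1)]
      by (simp del: fun_upd_apply)
  next
    case False
    have "distinct ?s" using IH(2) by auto
    then show ?thesis
      unfolding strategy_snoc if_not_P[OF False] set_s using IH(1) False by simp
  qed
qed

lemma adaptive: "adaptive_online_adversary k n request answer"
  unfolding adaptive_online_adversary_def
proof (intro ballI conjI)
  fix h assume h: "h \<in> lists (configs k n)"
  note inv = strategy_invariant[OF h]
  show a: "answer h \<in> configs k n" using inv by simp
  show "request h \<in> configs k n"
    using a fresh(1) by (auto simp: request_def configs_def)
  have "set (stack h) \<subseteq> {1..k}" "stack h \<noteq> []" using inv by auto
  then have "hd (stack h) \<in> {1..k}" using hd_in_set[of "stack h"] by blast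
  then show "serves k (answer h) (request h)"
    by (auto simp: serves_def request_def)
qed

section \<open>One request against the memoryless algorithm\<close>

context
  fixes h q
  assumes h: "h \<in> lists (configs k n)" "h \<noteq> []" and q: "q = last h"
begin

text \<open>At the top of the stack the request is the adversary's position, and stack elements are
  disagreements; elsewhere it is fresh. Hence the algorithm never serves a request for free.\<close>

lemma request_not_current:
  assumes "i \<in> {1..k}"
  shows "request h i \<noteq> q i"
proof (cases "i = hd (stack h)")
  case True
  have "stack h \<noteq> []"
    using strategy_invariant[OF h(1)] by simp
  then have "i \<in> set (stack h)"
    unfolding True by (rule hd_in_set)
  then have "q i \<noteq> answer h i"
    using strategy_invariant[OF h(1)] h(2) q by auto
  then show ?thesis
    using True assms by (simp add: request_def)
next
  case False
  then show ?thesis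
    using assms fresh(2)[of "q i"] h(2) q by (simp add: request_def)
qed

lemma step_config:
  assumes "j \<in> {1..k}"
  shows "q(j := request h j) \<in> configs k n"
proof -
  have "q \<in> configs k n" using h q by auto
  moreover have "request h \<in> configs k n"
    using adaptive h(1) by (simp add: adaptive_online_adversary_def)
  then have "request h j \<in> {1..n}"
    using assms by (auto simp: configs_def)
  ultimately show ?thesis
    using config_update assms by blast
qed

lemma memoryless_step_request:
  "memoryless_step k p (request h) q = map_pmf (\<lambda>j. q(j := request h j)) p"
proof -
  have "\<not> serves k q (request h)"
    using request_not_current by (force simp: serves_def)
  then show ?thesis
    by (simp add: memoryless_step_def)
qed

text \<open>Moving \<open>x\<close> lands on the adversary's position and moving any other server
  lands off it, so only the status of \<open>j\<close> can change. The four cases are reset, pop, no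
  change and push.\<close>

lemma stack_step:
  assumes s: "stack h = x # s" and j: "j \<in> {1..k}"
  defines "h' \<equiv> h @ [q(j := request h j)]"
  shows "j = x \<Longrightarrow> s = [] \<Longrightarrow> stack h' = [m] \<and> hamming k (answer h) (answer h') = 1"
    and "j = x \<Longrightarrow> s \<noteq> [] \<Longrightarrow> stack h' = s \<and> answer h' = answer h"
    and "j \<in> set s \<Longrightarrow> stack h' = x # s \<and> answer h' = answer h"
    and "j \<notin> set (x # s) \<Longrightarrow> stack h' = j # x # s \<and> answer h' = answer h"
proof -
  let ?a = "answer h" and ?q = "q(j := request h j)"
  let ?new = "[i \<leftarrow> [1..<Suc k]. ?q i \<noteq> ?a i \<and> i \<notin> set (stack h)]"
  let ?old = "[i \<leftarrow> stack h. ?q i \<noteq> ?a i]"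
  note inv = strategy_invariant[OF h(1)]
  have set_s: "set (x # s) = {i \<in> {1..k}. q i \<noteq> ?a i}"
    using inv h(2) q s by simp
  have dist: "distinct (x # s)" using inv s by simp
  have at_x: "request h x = ?a x"
    using set_s by (auto simp: request_def s)
  have off_x: "request h j \<noteq> ?a j" if "j \<noteq> x"
    using that j fresh(3) by (auto simp: request_def s)
  have new: "?new = (if j \<notin> set (x # s) then [j] else [])"
  proof -
    have "?new = [i \<leftarrow> [1..<Suc k]. i = j \<and> j \<notin> set (x # s)]"
    proof (rule filter_cong[OF refl])
      fix i assume "i \<in> set [1..<Suc k]"
      then have i: "i \<in> {1..k}" by auto
      show "(?q i \<noteq> ?a i \<and> i \<notin> set (stack h)) = (i = j \<and> j \<notin> set (x # s))"
      proof (cases "i = j")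
        case True
        then show ?thesis using off_x s by auto
      next
        case False
        have "q i \<noteq> ?a i \<longleftrightarrow> i \<in> set (x # s)" using set_s i by blast
        then show ?thesis using False s by auto
      qed
    qed
    also have "\<dots> = (if j \<notin> set (x # s) then [i \<leftarrow> [1..<Suc k]. i = j] else [])"
      by simp
    also have "[i \<leftarrow> [1..<Suc k]. i = j] = [j]"
    proof -
      have "[1..<Suc k] = [1..<j] @ j # [Suc j..<Suc k]"
        using j upt_add_eq_append[of 1 j "Suc k - j"] by (simp add: upt_conv_Cons)
      moreover have "[i \<leftarrow> [1..<j]. i = j] = []" "[i \<leftarrow> [Suc j..<Suc k]. i = j] = []"
        by (auto simp: filter_empty_conv)
      ultimately show ?thesis by simp
    qed
    finally show ?thesis .
  qed
  have old: "?old = (if j = x then s else x # s)"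
  proof -
    have keep: "?q i \<noteq> ?a i \<longleftrightarrow> \<not> (i = j \<and> j = x)" if "i \<in> set (x # s)" for i
    proof (cases "i = j")
      case True
      then show ?thesis using off_x at_x by auto
    next
      case False
      have "q i \<noteq> ?a i" using that set_s by blast
      then show ?thesis using False by simp
    qed
    have "?old = [i \<leftarrow> x # s. \<not> (i = j \<and> j = x)]"
      unfolding s by (rule filter_cong[OF refl]) (rule keep)
    also have "\<dots> = (if j = x then s else x # s)"
      using dist by (auto simp: filter_id_conv)
    finally show ?thesis .
  qed
  note step = strategy_snoc[of h ?q, folded h'_def, unfolded new old]
  show "stack h' = [m] \<and> hamming k ?a (answer h') = 1" if "j = x" "s = []"
    using that step hamming_update[OF m fresh(2)] by simp
  show "stack h' = s \<and> answer h' = ?a" if "j = x" "s \<noteq> []"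
    using that step by simp
  show "stack h' = x # s \<and> answer h' = ?a" if "j \<in> set s"
    using that step dist by auto
  show "stack h' = j # x # s \<and> answer h' = ?a" if "j \<notin> set (x # s)"
    using that step by auto
qed

end

text \<open>Pushes and pops act at the top and a reset installs \<open>[m]\<close>, so the bottom
  stays \<open>m\<close>.\<close>

lemma run_invariant:
  assumes p: "set_pmf p \<subseteq> {1..k}" and "h \<in> set_pmf (run k p request q0 t)"
  shows "h \<in> lists (configs k n) \<and> length h = Suc t \<and> last (stack h) = m \<and> alg_cost k t h = t"
  using assms(2)
proof (induction t arbitrary: h)
  case 0
  \<comment> \<open>Runs start with \<open>[q0]\<close>, not \<open>[]\<close>; this first update
    finds the disagreement at \<open>m\<close> already on the stack and changes nothing.\<close>
  have "stack [q0] = [m]"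
    using m q0 fresh(2)[of "q0 m" "q0 m"] strategy_snoc(2)[of "[]" q0]
    by (auto simp: stack_def answer_def)
  then show ?case
    using 0 q0 by (simp add: alg_cost_def)
next
  case (Suc t)
  then obtain g q where g: "g \<in> set_pmf (run k p request q0 t)"
      and q: "q \<in> set_pmf (memoryless_step k p (request g) (last g))" and h: "h = g @ [q]"
    by auto
  note IH = Suc.IH[OF g]
  then have g': "g \<in> lists (configs k n)" "g \<noteq> []" by auto
  obtain j where j: "j \<in> {1..k}" and q: "q = (last g)(j := request g j)"
    using q p memoryless_step_request[OF g' refl] by auto
  obtain x s where s: "stack g = x # s"
    using strategy_invariant[OF g'(1)] by (cases "stack g") auto
  have "last (stack h) = m"
    using stack_step[OF g' refl s j] IH s unfolding h q
    by (cases "j = x"; cases "s = []"; cases "j \<in> set s") auto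
  moreover have "hamming k (last g) q = 1"
    unfolding q using hamming_update[OF j] request_not_current[OF g' refl j] by simp
  ultimately show ?case
    using IH step_config[OF g' refl j] by (auto simp: h q alg_cost_snoc)
qed

end

section \<open>Potential function and submartingale\<close>

text \<open>
  Lower bound for the expected number of requests until the stack is emptied; the second argument
  bounds the time to pop the bottom element, \<open>c j\<close> stands for \<open>1 / p j\<close>.
\<close>

fun potential :: "nat \<Rightarrow> real \<Rightarrow> (nat \<Rightarrow> real) \<Rightarrow> nat list \<Rightarrow> real" where
  "potential k M c [] = 0"
| "potential k M c [x] = M"
| "potential k M c (x # y # s) = real (alpha (k - Suc (length s))) * c x + potential k M c (y # s)"

locale stack_vs_memoryless = stack_adversary +
  fixes p :: "nat pmf"
  assumes p: "set_pmf p \<subseteq> {1..k}"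
    and m_least: "\<And>j. j \<in> {1..k} \<Longrightarrow> pmf p m \<le> pmf p j"
begin

definition ratio :: real where
  "ratio = real (k * alpha k)"

text \<open>If \<open>p m = 0\<close>, the bottom of the stack is never removed and it suffices to count it alone.\<close>

definition weight :: "nat \<Rightarrow> real" where
  "weight j = (if pmf p m = 0 then 0 else 1 / pmf p j)"

abbreviation \<Phi> :: "nat list \<Rightarrow> real" where
  "\<Phi> \<equiv> potential k ratio weight"

lemma finite_p: "finite (set_pmf p)"
  using p finite_subset by blast

lemma expectation_p: "measure_pmf.expectation p f = (\<Sum>j\<in>{1..k}. pmf p j * f j)" for f :: "nat \<Rightarrow> real"
  using p by (subst integral_measure_pmf[of "{1..k}"]) (auto simp: mult.commute)

lemma sum_p: "(\<Sum>j\<in>{1..k}. pmf p j) = 1"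
  using p by (intro sum_pmf_eq_1) auto

lemma pmf_m_le: "real k * pmf p m \<le> 1"
  using sum_bounded_below[of "{1..k}" "pmf p m" "pmf p"] m_least sum_p by simp

text \<open>This drift bound makes \<open>balance\<close> a submartingale. For
  \<open>pmf p m > 0\<close> it is an equality unless \<open>x\<close> is the bottom, by the
  recurrence for \<open>alpha\<close>.\<close>

lemma potential_drift:
  assumes s: "distinct (x # s)" "set (x # s) \<subseteq> {1..k}" "last (x # s) = m"
  shows "pmf p x * (\<Phi> (x # s) - \<Phi> s)
    \<le> 1 + (\<Sum>j\<in>{1..k} - set (x # s). pmf p j * (\<Phi> (j # x # s) - \<Phi> (x # s)))"
proof (cases "pmf p m = 0")
  case True
  \<comment> \<open>All weights are 0, so every nonempty stack has potential \<open>ratio\<close>,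
    and the only loss, popping \<open>m\<close> from \<open>[m]\<close>, has probability 0.\<close>
  then show ?thesis
    using s by (cases s) (auto simp: weight_def)
next
  case False
  then have pos: "pmf p m > 0" using pmf_nonneg[of p m] by linarith
  then have c: "pmf p j * weight j = 1" if "j \<in> {1..k}" for j
    using m_least[OF that] by (simp add: weight_def)
  let ?l = "length s"
  have "card (set (x # s)) = Suc ?l" using s(1) by (metis distinct_card length_Cons)
  moreover have "card (set (x # s)) \<le> card {1..k}" using s(2) by (intro card_mono) auto
  moreover have "card ({1..k} - set (x # s)) = card {1..k} - card (set (x # s))"
    using s(2) by (intro card_Diff_subset) auto
  ultimately have card: "card ({1..k} - set (x # s)) = k - Suc ?l" and le: "Suc ?l \<le> k"
    by auto
  \<comment> \<open>Above the bottom the factor \<open>weight x\<close> cancels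
    \<open>pmf p x\<close>; at the bottom \<open>pmf_m_le\<close> absorbs the factor
    \<open>k\<close> of \<open>ratio\<close>.\<close>
  have "pmf p x * (\<Phi> (x # s) - \<Phi> s) \<le> real (alpha (k - ?l))"
  proof (cases s)
    case Nil
    then show ?thesis
      using s mult_right_mono[OF pmf_m_le, of "real (alpha k)"] by (simp add: ratio_def mult_ac)
  next
    case (Cons y s')
    then show ?thesis
      using c[of x] s(2) by (simp add: mult.left_commute[of "pmf p x"])
  qed
  also have "k - ?l = Suc (k - Suc ?l)" using le by simp
  \<comment> \<open>If all positions are on the stack, the factor 0 cancels the dummy
    \<open>alpha 0\<close>.\<close>
  then have "real (alpha (k - ?l)) = 1 + real (k - Suc ?l) * real (alpha (k - Suc ?l))"
    by (simp only: alpha_Suc of_nat_add of_nat_mult of_nat_1)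
  also have "\<dots> = 1 + (\<Sum>j\<in>{1..k} - set (x # s). real (alpha (k - Suc ?l)))"
    by (simp only: sum_constant card)
  also have "(\<Sum>j\<in>{1..k} - set (x # s). real (alpha (k - Suc ?l)))
      = (\<Sum>j\<in>{1..k} - set (x # s). pmf p j * (\<Phi> (j # x # s) - \<Phi> (x # s)))"
    using c by (intro sum.cong refl) (simp add: mult.left_commute)
  finally show ?thesis .
qed

text \<open>The index is \<open>Suc t\<close> because \<open>answer h\<close> is already the
  configuration after the next request, so a reset is charged as soon as it happens.\<close>

definition balance :: "nat \<Rightarrow> (nat \<Rightarrow> nat) list \<Rightarrow> real" where
  "balance t h = real t + \<Phi> (stack h) - ratio * real (adv_cost k answer q0 (Suc t) h)"

lemma balance_step:
  assumes "h \<in> set_pmf (run k p request q0 t)"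
  shows "balance t h \<le> measure_pmf.expectation p
    (\<lambda>j. balance (Suc t) (h @ [(last h)(j := request h j)]))"
proof -
  note inv = run_invariant[OF p assms]
  then have h: "h \<in> lists (configs k n)" "h \<noteq> []" by auto
  note inv' = strategy_invariant[OF h(1)]
  obtain x s where s: "stack h = x # s"
    using inv' by (cases "stack h") auto
  let ?h = "\<lambda>j. h @ [(last h)(j := request h j)]"
  \<comment> \<open>Popping the last element counts as reaching potential 0: the reset raises the
    potential to \<open>ratio\<close>, but the adversary's move costs \<open>ratio\<close> in the
    balance.\<close>
  let ?d = "\<lambda>j. if j = x then \<Phi> s - \<Phi> (x # s) else if j \<in> set s then 0
                else \<Phi> (j # x # s) - \<Phi> (x # s)"
  have xs: "distinct (x # s)" "set (x # s) \<subseteq> {1..k}" "last (x # s) = m"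
    using inv inv' s by auto
  have "adv_config answer q0 h (Suc t) = answer h"
    using inv by (simp add: adv_config_def)
  then have adv: "adv_cost k answer q0 (Suc (Suc t)) (?h j)
      = adv_cost k answer q0 (Suc t) h + hamming k (answer h) (answer (?h j))" for j
    using inv adv_cost_snoc[of h "Suc t"] by simp
  have step: "balance (Suc t) (?h j) = balance t h + 1 + ?d j" if j: "j \<in> {1..k}" for j
    using stack_step[OF h refl s j] s xs(3) unfolding balance_def adv
    by (cases "j = x"; cases "s = []"; cases "j \<in> set s") (auto simp: algebra_simps)
  have x: "x \<in> {1..k}" using xs by auto
  have "(\<Sum>j\<in>{1..k}. pmf p j * ?d j)
      = (\<Sum>j\<in>set (x # s). pmf p j * ?d j) + (\<Sum>j\<in>{1..k} - set (x # s). pmf p j * ?d j)"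
    using sum.subset_diff[OF xs(2), of "\<lambda>j. pmf p j * ?d j"] by simp
  also have "(\<Sum>j\<in>set (x # s). pmf p j * ?d j) = pmf p x * (\<Phi> s - \<Phi> (x # s))"
    using xs(1) by (simp add: sum.neutral)
  also have "(\<Sum>j\<in>{1..k} - set (x # s). pmf p j * ?d j)
      = (\<Sum>j\<in>{1..k} - set (x # s). pmf p j * (\<Phi> (j # x # s) - \<Phi> (x # s)))"
    by (intro sum.cong) auto
  finally have "(\<Sum>j\<in>{1..k}. pmf p j * ?d j) \<ge> - 1"
    using potential_drift[OF xs] by (simp add: algebra_simps)
  moreover have "(\<Sum>j\<in>{1..k}. pmf p j * balance (Suc t) (?h j))
      = (\<Sum>j\<in>{1..k}. pmf p j * (balance t h + 1) + pmf p j * ?d j)"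
    by (intro sum.cong refl) (simp only: step distrib_left)
  then have "(\<Sum>j\<in>{1..k}. pmf p j * balance (Suc t) (?h j))
      = balance t h + 1 + (\<Sum>j\<in>{1..k}. pmf p j * ?d j)"
    by (simp only: sum.distrib flip: sum_distrib_right) (simp only: sum_p mult_1)
  ultimately show ?thesis
    by (simp only: expectation_p)
qed

text \<open>The initial balance is 0, since the potential \<open>ratio\<close> of \<open>[m]\<close>
  pays for the adversary's first move; by \<open>balance_step\<close> the expectation never
  decreases.\<close>

lemma balance_nonneg: "0 \<le> measure_pmf.expectation (run k p request q0 t) (balance t)"
proof (induction t)
  case 0
  have "stack [q0] = [m] \<and> answer [q0] = q0(m := fresh (q0 m) (q0 m))"
    using m q0 fresh(2)[of "q0 m" "q0 m"] strategy_snoc[of "[]" q0]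
    by (auto simp: stack_def answer_def)
  then have "balance 0 [q0] = 0"
    using hamming_update[OF m fresh(2)] by (simp add: balance_def adv_cost_def adv_config_def)
  then show ?case by simp
next
  case (Suc t)
  let ?run = "run k p request q0"
  let ?K = "\<lambda>h. map_pmf (\<lambda>q. h @ [q]) (memoryless_step k p (request h) (last h))"
  have "measure_pmf.expectation (?run t) (balance t)
      \<le> measure_pmf.expectation (?run t) (\<lambda>h. measure_pmf.expectation (?K h) (balance (Suc t)))"
  proof (rule expectation_mono_finite[OF finite_set_pmf_run[OF finite_p]])
    fix h assume h: "h \<in> set_pmf (?run t)"
    then have "h \<in> lists (configs k n)" "h \<noteq> []"
      using run_invariant[OF p h] by auto
    from memoryless_step_request[OF this refl] balance_step[OF h]
    show "balance t h \<le> measure_pmf.expectation (?K h) (balance (Suc t))"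
      by simp
  qed
  also have "\<dots> = measure_pmf.expectation (?run (Suc t)) (balance (Suc t))"
    using finite_p
    by (subst run.simps(2), subst expectation_bind_finite)
      (auto simp: finite_set_pmf_run memoryless_step_def)
  finally show ?case using Suc by linarith
qed

lemma adv_cost_bound:
  obtains B where "\<And>t. ratio * measure_pmf.expectation (run k p request q0 t)
    (\<lambda>h. real (adv_cost k answer q0 t h)) \<le> real t + B"
proof
  \<comment> \<open>There are finitely many duplicate-free stacks, so the potential has a bound
    independent of \<open>t\<close>.\<close>
  define S where "S = {s. distinct s \<and> set s \<subseteq> {1..k}}"
  define B where "B = Max (\<Phi> ` S)"
  have "finite S"
    using finite_subset_distinct[of "{1..k}"] by (auto simp: S_def conj_commute)
  then have B: "\<Phi> s \<le> B" if "s \<in> S" for s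
    using that by (auto simp: B_def)
  fix t
  let ?run = "run k p request q0 t"
  note fin = finite_set_pmf_run[OF finite_p]
  have "ratio * real (adv_cost k answer q0 t h) + balance t h \<le> real t + B"
    if h: "h \<in> set_pmf ?run" for h
  proof -
    have "h \<in> lists (configs k n)" using run_invariant[OF p h] by auto
    from strategy_invariant[OF this] have "\<Phi> (stack h) \<le> B"
      by (intro B) (auto simp: S_def)
    \<comment> \<open>The balance charges one adversary move more than the \<open>t\<close> requests
      of the run.\<close>
    moreover have "ratio * real (adv_cost k answer q0 t h)
        \<le> ratio * real (adv_cost k answer q0 (Suc t) h)"
      by (intro mult_left_mono) (auto simp: ratio_def adv_cost_mono simp del: of_nat_mult)
    ultimately show ?thesis by (simp add: balance_def)
  qed
  then have "measure_pmf.expectation ?run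
      (\<lambda>h. ratio * real (adv_cost k answer q0 t h) + balance t h)
      \<le> measure_pmf.expectation ?run (\<lambda>h. real t + B)"
    by (intro expectation_mono_finite fin)
  also have "measure_pmf.expectation ?run
      (\<lambda>h. ratio * real (adv_cost k answer q0 t h) + balance t h)
      = ratio * measure_pmf.expectation ?run (\<lambda>h. real (adv_cost k answer q0 t h))
        + measure_pmf.expectation ?run (balance t)"
    by (subst Bochner_Integration.integral_add) (auto intro: integrable_measure_pmf_finite fin)
  finally show "ratio * measure_pmf.expectation ?run (\<lambda>h. real (adv_cost k answer q0 t h))
      \<le> real t + B"
    using balance_nonneg[of t] by simp
qed

text \<open>The algorithm pays exactly \<open>t\<close> and the adversary at most
  \<open>(t + B) / ratio\<close> in expectation, so \<open>c < ratio\<close> fails for large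
  \<open>t\<close>.\<close>

lemma competitive_ge_ratio:
  assumes "competitive k n p c"
  shows "ratio \<le> c"
proof (rule ccontr)
  assume "\<not> ratio \<le> c"
  \<comment> \<open>A negative \<open>c\<close> is raised to 0, which stays below
    \<open>ratio\<close> and allows multiplying the bound on the adversary's cost.\<close>
  define d where "d = max c 0"
  let ?adv = "\<lambda>t. measure_pmf.expectation (run k p request q0 t)
                  (\<lambda>h. real (adv_cost k answer q0 t h))"
  have "k > 0" using m by auto
  then obtain l where "k = Suc l" by (cases k) auto
  then have "alpha k > 0" by (simp add: alpha_Suc)
  then have "ratio > 0" using \<open>k > 0\<close> by (simp add: ratio_def)
  then have d: "0 \<le> d" "d < ratio" "c \<le> d"
    using \<open>\<not> ratio \<le> c\<close> by (auto simp: d_def)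
  obtain b where b: "\<And>t. measure_pmf.expectation (run k p request q0 t)
      (\<lambda>h. real (alg_cost k t h)) \<le> c * ?adv t + b"
    using assms q0 adaptive unfolding competitive_def by blast
  obtain B where B: "\<And>t. ratio * ?adv t \<le> real t + B"
    using adv_cost_bound by blast
  have main: "ratio * real t \<le> d * (real t + B) + ratio * b" for t
  proof -
    have "measure_pmf.expectation (run k p request q0 t) (\<lambda>h. real (alg_cost k t h))
        = measure_pmf.expectation (run k p request q0 t) (\<lambda>h. real t)"
      by (intro integral_cong_AE) (auto simp: AE_measure_pmf_iff dest: run_invariant[OF p])
    then have "real t \<le> c * ?adv t + b" using b[of t] by simp
    also have "\<dots> \<le> d * ?adv t + b"
      using d by (intro add_right_mono mult_right_mono) auto
    finally have "ratio * real t \<le> ratio * (d * ?adv t + b)"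
      using \<open>ratio > 0\<close> by simp
    also have "\<dots> = d * (ratio * ?adv t) + ratio * b" by (simp add: algebra_simps)
    also have "\<dots> \<le> d * (real t + B) + ratio * b"
      using B d by (intro add_right_mono mult_left_mono) auto
    finally show ?thesis .
  qed
  obtain t where "(d * B + ratio * b) / (ratio - d) < real t"
    using reals_Archimedean2 by blast
  then have "d * B + ratio * b < real t * (ratio - d)"
    using d by (simp add: divide_less_eq)
  then show False using main[of t] by (simp add: algebra_simps)
qed

end

theorem theorem2:
  fixes k n :: nat and p :: "nat pmf"
  assumes "k \<ge> 1" and "n \<ge> 3"
    and "set_pmf p \<subseteq> {1..k}"
  shows "competitive_ratio k n p \<ge> ereal (real (k * alpha k))"
proof -
  \<comment> \<open>Competitiveness is demanded from every initial configuration, so a lower bound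
    needs only one.\<close>
  define q0 where "q0 = (\<lambda>i\<in>{1..k}. 1::nat)"
  have q0: "q0 \<in> configs k n"
    using assms by (auto simp: q0_def configs_def)
  have "{1..k} \<noteq> {}" using assms by auto
  then obtain m where m: "is_arg_min (pmf p) (\<lambda>j. j \<in> {1..k}) m"
    using ex_is_arg_min_if_finite[of "{1..k}" "pmf p"] by auto
  interpret stack_vs_memoryless k n m q0 p
    using assms q0 m by unfold_locales (auto simp: is_arg_min_linorder)
  show ?thesis
    unfolding competitive_ratio_def
    using competitive_ge_ratio by (auto intro!: Inf_greatest simp: ratio_def)
qed

end
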